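(* Let $d>1$ be an odd integer, let $X$ be a connected simplicial set and let $\gamma:X_2\to\mathbb{Z}_d$ be a normalized $2$-cocycle. Let $w$ be a word in the generators of $\pi_1(\mathbb{Z}_d,X_\gamma)$ and let $a\in\mathbb{Z}_d$. If the equation $w=e_1^aw^{\mathrm{op}}$ holds in $\pi_1(\mathbb{Z}_d,X_\gamma)$, then $w=w^{\mathrm{op}}$ holds in $\pi_1(\mathbb{Z}_d,X_\gamma)$.
   Context: A $2$-cocycle $\gamma$ (for simplicial cohomology with $\mathbb{Z}_d$ coefficients) is normalized if $\gamma(s_0x)=\gamma(s_1x)=0$ for all $x\in X_1$. The twisted product $X_\gamma$ is the simplicial set with $n$-simplices $\mathbb{Z}_d^n\times X_n$, $d_i(\alpha,\tau)=(d_i\alpha,d_i\tau)$ for $1\le i\le n$, $s_j(\alpha,\tau)=(s_j\alpha,s_j\tau)$, $d_0(\alpha,\tau)=(\eta(\tau)+d_0\alpha,d_0\tau)$, where structure maps on $\alpha$ are those of the nerve $N\mathbb{Z}_d$, and $\eta(\tau)\in\mathbb{Z}_d^{n-1}$ is given by $\eta(\tau)_1=\gamma(\tau|_{012})$, $\eta(\tau)_i=\gamma(\tau|_{0,i,i+1})-\gamma(\tau|_{1,i,i+1})$ for $2\le i\le n-1$ ($\tau|_{ijk}$ is the face of $\tau\in X_n$ on vertices $i,j,k$). In particular $d_0((a,b),\sigma)=(\gamma(\sigma)+b,d_0\sigma)$ for $\sigma\in X_2$. For a simplicial set $Y$, $\pi_1(\mathbb{Z}_d,Y)$ is the group generated by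 $e_y$, $y\in Y_1$, with relations $e_y^d=1$ for $y\in Y_1$, and $[e_{d_i\sigma},e_{d_j\sigma}]=1$, $e_{d_2\sigma}e_{d_0\sigma}=e_{d_1\sigma}$ for $\sigma\in Y_2$, $i,j\in\{0,1,2\}$. In $\pi_1(\mathbb{Z}_d,X_\gamma)$ write $e_{a,x}$ for the generator of $(a,x)\in\mathbb{Z}_d\times X_1$ and $e_1=e_{1,s_0v}$ for any vertex $v$ of $X$ (independent of $v$ since $X$ is connected). A word is a product $w=e_{x_1}e_{x_2}\cdots e_{x_l}$ of generators; its opposite is $w^{\mathrm{op}}=e_{x_l}\cdots e_{x_2}e_{x_1}$. *)

theory Defs
  imports "HOL-Algebra.Group"
begin

section \<open>Simplicial sets\<close>

text \<open>
  \<open>face X n i\<close> is \<open>d\<^sub>i : X\<^sub>n \<rightarrow> X\<^sub>n\<^sub>-\<^sub>1\<close> and \<open>degen X n j\<close> is \<open>s\<^sub>j : X\<^sub>n \<rightarrow> X\<^sub>n\<^sub>+\<^sub>1\<close>: the index \<open>n\<close>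
  is always the dimension of the argument.
\<close>

record 'a sset =
  simplices :: "nat \<Rightarrow> 'a set"
  face :: "nat \<Rightarrow> nat \<Rightarrow> 'a \<Rightarrow> 'a"
  degen :: "nat \<Rightarrow> nat \<Rightarrow> 'a \<Rightarrow> 'a"

locale simplicial_set =
  fixes X :: "'a sset"
  assumes face_closed:
      "\<And>n i x. i \<le> Suc n \<Longrightarrow> x \<in> simplices X (Suc n) \<Longrightarrow> face X (Suc n) i x \<in> simplices X n"
    and degen_closed:
      "\<And>n j x. j \<le> n \<Longrightarrow> x \<in> simplices X n \<Longrightarrow> degen X n j x \<in> simplices X (Suc n)"
    and face_face:
      "\<And>n i j x. i < j \<Longrightarrow> j \<le> Suc (Suc n) \<Longrightarrow> x \<in> simplices X (Suc (Suc n)) \<Longrightarrow>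
        face X (Suc n) i (face X (Suc (Suc n)) j x)
          = face X (Suc n) (j - 1) (face X (Suc (Suc n)) i x)"
    and face_degen_less:
      "\<And>n i j x. i < j \<Longrightarrow> j \<le> Suc n \<Longrightarrow> x \<in> simplices X (Suc n) \<Longrightarrow>
        face X (Suc (Suc n)) i (degen X (Suc n) j x) = degen X n (j - 1) (face X (Suc n) i x)"
    and face_degen_same:
      "\<And>n j x. j \<le> n \<Longrightarrow> x \<in> simplices X n \<Longrightarrow> face X (Suc n) j (degen X n j x) = x"
    and face_degen_Suc:
      "\<And>n j x. j \<le> n \<Longrightarrow> x \<in> simplices X n \<Longrightarrow> face X (Suc n) (Suc j) (degen X n j x) = x"
    and face_degen_greater:
      "\<And>n i j x. Suc j < i \<Longrightarrow> i \<le> Suc (Suc n) \<Longrightarrow> x \<in> simplices X (Suc n) \<Longrightarrow>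
        face X (Suc (Suc n)) i (degen X (Suc n) j x) = degen X n j (face X (Suc n) (i - 1) x)"
    and degen_degen:
      "\<And>n i j x. i \<le> j \<Longrightarrow> j \<le> n \<Longrightarrow> x \<in> simplices X n \<Longrightarrow>
        degen X (Suc n) i (degen X n j x) = degen X (Suc n) (Suc j) (degen X n i x)"

definition edge_rel :: "'a sset \<Rightarrow> ('a \<times> 'a) set" where
  "edge_rel X = {(face X 1 1 x, face X 1 0 x) | x. x \<in> simplices X 1}"

definition connected_sset :: "'a sset \<Rightarrow> bool" where
  "connected_sset X \<longleftrightarrow> simplices X 0 \<noteq> {} \<and>
     (\<forall>v \<in> simplices X 0. \<forall>w \<in> simplices X 0. (v, w) \<in> (edge_rel X \<union> (edge_rel X)\<inverse>)\<^sup>*)"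


section \<open>Cocycles\<close>

text \<open>Elements of \<open>\<int>\<^sub>d\<close> are represented by their residues in \<open>{0..<d}\<close>.\<close>

definition Zd :: "nat \<Rightarrow> int set" where
  "Zd d = {0..<int d}"

definition cocycle2 :: "nat \<Rightarrow> 'a sset \<Rightarrow> ('a \<Rightarrow> int) \<Rightarrow> bool" where
  "cocycle2 d X \<gamma> \<longleftrightarrow> \<gamma> \<in> simplices X 2 \<rightarrow> Zd d \<and>
     (\<forall>\<tau> \<in> simplices X 3.
        (\<gamma> (face X 3 0 \<tau>) - \<gamma> (face X 3 1 \<tau>) + \<gamma> (face X 3 2 \<tau>) - \<gamma> (face X 3 3 \<tau>)) mod int d = 0)"

definition normalized2 :: "'a sset \<Rightarrow> ('a \<Rightarrow> int) \<Rightarrow> bool" where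
  "normalized2 X \<gamma> \<longleftrightarrow>
     (\<forall>x \<in> simplices X 1. \<gamma> (degen X 1 0 x) = 0 \<and> \<gamma> (degen X 1 1 x) = 0)"


section \<open>Twisted products\<close>

definition nerve_Zd :: "nat \<Rightarrow> int list sset" where
  "nerve_Zd d = \<lparr>
     simplices = (\<lambda>n. {\<alpha>. length \<alpha> = n \<and> set \<alpha> \<subseteq> Zd d}),
     face = (\<lambda>n i \<alpha>. if i = 0 then tl \<alpha> else if i = n then butlast \<alpha>
               else take (i - 1) \<alpha> @ ((\<alpha> ! (i - 1) + \<alpha> ! i) mod int d) # drop (i + 1) \<alpha>),
     degen = (\<lambda>n j \<alpha>. take j \<alpha> @ 0 # drop j \<alpha>) \<rparr>"

text \<open>Successive deletion of vertices; a listed index refers to the simplex reached so far.\<close>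

fun del_vertices :: "'a sset \<Rightarrow> nat \<Rightarrow> nat list \<Rightarrow> 'a \<Rightarrow> 'a" where
  "del_vertices X n [] \<tau> = \<tau>"
| "del_vertices X n (m # ms) \<tau> = del_vertices X (n - 1) ms (face X n m \<tau>)"

text \<open>
  The face of an \<open>n\<close>-simplex on its vertices \<open>i, j, k\<close>. The other vertices are deleted from the
  highest to the lowest, so no deletion renumbers a vertex that is still to be deleted.
\<close>

definition tri_face :: "'a sset \<Rightarrow> nat \<Rightarrow> nat \<Rightarrow> nat \<Rightarrow> nat \<Rightarrow> 'a \<Rightarrow> 'a" where
  "tri_face X n i j k = del_vertices X n (rev (filter (\<lambda>m. m \<notin> {i, j, k}) [0..<Suc n]))"

definition twist :: "nat \<Rightarrow> 'a sset \<Rightarrow> ('a \<Rightarrow> int) \<Rightarrow> nat \<Rightarrow> 'a \<Rightarrow> int list" where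
  "twist d X \<gamma> n \<tau> = map (\<lambda>i. if i = 1 then \<gamma> (tri_face X n 0 1 2 \<tau>)
     else (\<gamma> (tri_face X n 0 i (i + 1) \<tau>) - \<gamma> (tri_face X n 1 i (i + 1) \<tau>)) mod int d) [1..<n]"

definition twisted_product :: "nat \<Rightarrow> 'a sset \<Rightarrow> ('a \<Rightarrow> int) \<Rightarrow> (int list \<times> 'a) sset" where
  "twisted_product d X \<gamma> = \<lparr>
     simplices = (\<lambda>n. simplices (nerve_Zd d) n \<times> simplices X n),
     face = (\<lambda>n i (\<alpha>, \<tau>).
       if i = 0
       then (map2 (\<lambda>s t. (s + t) mod int d) (twist d X \<gamma> n \<tau>) (face (nerve_Zd d) n 0 \<alpha>), face X n 0 \<tau>)
       else (face (nerve_Zd d) n i \<alpha>, face X n i \<tau>)),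
     degen = (\<lambda>n j (\<alpha>, \<tau>). (degen (nerve_Zd d) n j \<alpha>, degen X n j \<tau>)) \<rparr>"

lemma twisted_product_face0_2:
  "face (twisted_product d X \<gamma>) 2 0 ([a, b], \<sigma>) = ([(\<gamma> \<sigma> + b) mod int d], face X 2 0 \<sigma>)"
  by (simp add: twisted_product_def nerve_Zd_def twist_def tri_face_def numeral_2_eq_2)


section \<open>Groups given by generators and relations\<close>

text \<open>
  The letter \<open>(True, s)\<close> stands for the generator \<open>s\<close> and \<open>(False, s)\<close> for its inverse.
  A relation \<open>u = v\<close> is given as the pair \<open>(u, v)\<close>.
\<close>

type_synonym 'g gword = "(bool \<times> 'g) list"

definition gwords :: "'g set \<Rightarrow> 'g gword set" where
  "gwords S = lists (UNIV \<times> S)"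

inductive pres_eq :: "'g set \<Rightarrow> ('g gword \<times> 'g gword) set \<Rightarrow> 'g gword \<Rightarrow> 'g gword \<Rightarrow> bool"
  for S R where
  refl: "w \<in> gwords S \<Longrightarrow> pres_eq S R w w"
| sym: "pres_eq S R u v \<Longrightarrow> pres_eq S R v u"
| trans: "pres_eq S R u v \<Longrightarrow> pres_eq S R v w \<Longrightarrow> pres_eq S R u w"
| cancel: "s \<in> S \<Longrightarrow> x \<in> gwords S \<Longrightarrow> y \<in> gwords S \<Longrightarrow>
    pres_eq S R (x @ [(b, s), (\<not> b, s)] @ y) (x @ y)"
| rel: "(u, v) \<in> R \<Longrightarrow> x \<in> gwords S \<Longrightarrow> y \<in> gwords S \<Longrightarrow>
    pres_eq S R (x @ u @ y) (x @ v @ y)"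

definition pres_class :: "'g set \<Rightarrow> ('g gword \<times> 'g gword) set \<Rightarrow> 'g gword \<Rightarrow> 'g gword set" where
  "pres_class S R u = {v. pres_eq S R u v}"

definition presented_group ::
    "'g set \<Rightarrow> ('g gword \<times> 'g gword) set \<Rightarrow> 'g gword set monoid" where
  "presented_group S R = \<lparr>
     carrier = pres_class S R ` gwords S,
     mult = (\<lambda>A B. \<Union>u \<in> A. \<Union>v \<in> B. pres_class S R (u @ v)),
     one = pres_class S R [] \<rparr>"

lemma gwords_simps [simp]:
  "[] \<in> gwords S"
  "p # w \<in> gwords S \<longleftrightarrow> snd p \<in> S \<and> w \<in> gwords S"
  "u @ w \<in> gwords S \<longleftrightarrow> u \<in> gwords S \<and> w \<in> gwords S"
  by (auto simp: gwords_def mem_Times_iff)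

lemma gwords_inverse:
  "w \<in> gwords S \<Longrightarrow> rev (map (\<lambda>(b, s). (\<not> b, s)) w) \<in> gwords S"
  by (induction w) auto

lemma pres_eq_gwords:
  assumes "R \<subseteq> gwords S \<times> gwords S" "pres_eq S R u v"
  shows "u \<in> gwords S \<and> v \<in> gwords S"
  using assms(2) by induction (use assms(1) in auto)

lemma pres_eq_context:
  assumes "pres_eq S R u v" "x \<in> gwords S" "y \<in> gwords S"
  shows "pres_eq S R (x @ u @ y) (x @ v @ y)"
  using assms
proof (induction)
  case (refl w)
  then show ?case by (intro pres_eq.refl) simp
next
  case (sym u v)
  then show ?case by (blast intro: pres_eq.sym)
next
  case (trans u v w)
  then show ?case by (blast intro: pres_eq.trans)
next
  case (cancel s x' y' b)
  then show ?case using pres_eq.cancel[of s S "x @ x'" "y' @ y" R b] by simp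
next
  case (rel u v x' y')
  then show ?case using pres_eq.rel[of u v R "x @ x'" S "y' @ y"] by simp
qed

lemma pres_eq_append:
  assumes "R \<subseteq> gwords S \<times> gwords S" "pres_eq S R u u'" "pres_eq S R v v'"
  shows "pres_eq S R (u @ v) (u' @ v')"
proof -
  have "pres_eq S R (u @ v) (u' @ v)"
    using pres_eq_context[OF assms(2), of "[]" v] pres_eq_gwords[OF assms(1,3)] by simp
  moreover have "pres_eq S R (u' @ v) (u' @ v')"
    using pres_eq_context[OF assms(3), of u' "[]"] pres_eq_gwords[OF assms(1,2)] by simp
  ultimately show ?thesis by (rule pres_eq.trans)
qed

lemma pres_class_eq_iff:
  assumes "u \<in> gwords S"
  shows "pres_class S R u = pres_class S R v \<longleftrightarrow> pres_eq S R u v"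
proof
  assume "pres_class S R u = pres_class S R v"
  moreover have "u \<in> pres_class S R u"
    using assms by (simp add: pres_class_def pres_eq.refl)
  ultimately show "pres_eq S R u v"
    by (simp add: pres_class_def pres_eq.sym)
next
  assume uv: "pres_eq S R u v"
  show "pres_class S R u = pres_class S R v"
    unfolding pres_class_def
    using pres_eq.trans[OF uv] pres_eq.trans[OF pres_eq.sym[OF uv]] by blast
qed

lemma presented_group_mult:
  assumes "R \<subseteq> gwords S \<times> gwords S" "u \<in> gwords S" "v \<in> gwords S"
  shows "pres_class S R u \<otimes>\<^bsub>presented_group S R\<^esub> pres_class S R v = pres_class S R (u @ v)"
proof -
  have "pres_class S R (u' @ v') = pres_class S R (u @ v)"
    if "u' \<in> pres_class S R u" "v' \<in> pres_class S R v" for u' v'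
  proof -
    have "pres_eq S R (u @ v) (u' @ v')"
      using that by (intro pres_eq_append[OF assms(1)]) (simp_all add: pres_class_def)
    then show ?thesis
      using assms(2,3) pres_class_eq_iff[of "u @ v" S R "u' @ v'"] by simp
  qed
  then have "(\<Union>u' \<in> pres_class S R u. \<Union>v' \<in> pres_class S R v. pres_class S R (u' @ v'))
      = (\<Union>u' \<in> pres_class S R u. \<Union>v' \<in> pres_class S R v. pres_class S R (u @ v))"
    by (intro SUP_cong HOL.refl)
  also have "\<dots> = pres_class S R (u @ v)"
  proof -
    have "u \<in> pres_class S R u" "v \<in> pres_class S R v"
      using assms(2,3) by (simp_all add: pres_class_def pres_eq.refl)
    then have "pres_class S R u \<noteq> {}" "pres_class S R v \<noteq> {}"
      by blast+
    then show ?thesis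
      by (simp only: UN_constant if_False)
  qed
  finally show ?thesis
    by (simp add: presented_group_def)
qed

lemma pres_eq_inverse:
  assumes "w \<in> gwords S"
  shows "pres_eq S R (rev (map (\<lambda>(b, s). (\<not> b, s)) w) @ w) []"
  using assms
proof (induction w)
  case Nil
  then show ?case by (simp add: pres_eq.refl)
next
  case (Cons p w)
  obtain b s where p: "p = (b, s)" by (cases p)
  let ?i = "rev (map (\<lambda>(b, s). (\<not> b, s)) w)"
  have "?i \<in> gwords S"
    using Cons.prems by (simp add: gwords_inverse)
  then have "pres_eq S R (?i @ [(\<not> b, s), (\<not> \<not> b, s)] @ w) (?i @ w)"
    using Cons.prems p by (intro pres_eq.cancel) auto
  then show ?case
    using Cons.IH Cons.prems p pres_eq.trans[of S R "?i @ [(\<not> b, s), (b, s)] @ w" "?i @ w" "[]"]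
    by simp
qed

lemma group_presented_group:
  assumes "R \<subseteq> gwords S \<times> gwords S"
  shows "group (presented_group S R)"
proof (rule groupI)
  let ?G = "presented_group S R"
  have car: "carrier ?G = pres_class S R ` gwords S"
    and one: "\<one>\<^bsub>?G\<^esub> = pres_class S R []"
    by (simp_all add: presented_group_def)
  note mult = presented_group_mult[OF assms]
  show "\<one>\<^bsub>?G\<^esub> \<in> carrier ?G"
    by (simp add: car one)
  show "x \<otimes>\<^bsub>?G\<^esub> y \<in> carrier ?G" if "x \<in> carrier ?G" "y \<in> carrier ?G" for x y
    using that by (auto simp: car mult)
  show "x \<otimes>\<^bsub>?G\<^esub> y \<otimes>\<^bsub>?G\<^esub> z = x \<otimes>\<^bsub>?G\<^esub> (y \<otimes>\<^bsub>?G\<^esub> z)"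
    if "x \<in> carrier ?G" "y \<in> carrier ?G" "z \<in> carrier ?G" for x y z
    using that by (auto simp: car mult)
  show "\<one>\<^bsub>?G\<^esub> \<otimes>\<^bsub>?G\<^esub> x = x" if "x \<in> carrier ?G" for x
    using that by (auto simp: car one mult)
  show "\<exists>y \<in> carrier ?G. y \<otimes>\<^bsub>?G\<^esub> x = \<one>\<^bsub>?G\<^esub>" if x: "x \<in> carrier ?G" for x
  proof -
    obtain w where w: "w \<in> gwords S" "x = pres_class S R w"
      using x by (auto simp: car)
    let ?i = "rev (map (\<lambda>(b, s). (\<not> b, s)) w)"
    have i: "?i \<in> gwords S"
      using w(1) by (rule gwords_inverse)
    have "pres_class S R ?i \<otimes>\<^bsub>?G\<^esub> x = \<one>\<^bsub>?G\<^esub>"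
      using pres_eq_inverse[OF w(1), of R] i w
      by (simp add: mult one pres_class_eq_iff)
    then show ?thesis
      using i by (auto simp: car)
  qed
qed


section \<open>The group \<open>\<pi>\<^sub>1(\<int>\<^sub>d, Y)\<close>\<close>

definition pi1_rels :: "nat \<Rightarrow> 'b sset \<Rightarrow> ('b gword \<times> 'b gword) set" where
  "pi1_rels d Y =
     {(replicate d (True, y), []) | y. y \<in> simplices Y 1}
   \<union> {([(True, face Y 2 i \<sigma>), (True, face Y 2 j \<sigma>), (False, face Y 2 i \<sigma>), (False, face Y 2 j \<sigma>)], [])
        | \<sigma> i j. \<sigma> \<in> simplices Y 2 \<and> i \<in> {0, 1, 2} \<and> j \<in> {0, 1, 2}}
   \<union> {([(True, face Y 2 2 \<sigma>), (True, face Y 2 0 \<sigma>)], [(True, face Y 2 1 \<sigma>)])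
        | \<sigma>. \<sigma> \<in> simplices Y 2}"

definition pi1 :: "nat \<Rightarrow> 'b sset \<Rightarrow> 'b gword set monoid" where
  "pi1 d Y = presented_group (simplices Y 1) (pi1_rels d Y)"

definition pi1_gen :: "nat \<Rightarrow> 'b sset \<Rightarrow> 'b \<Rightarrow> 'b gword set" where
  "pi1_gen d Y y = pres_class (simplices Y 1) (pi1_rels d Y) [(True, y)]"

text \<open>
  A word \<open>e\<^bsub>x\<^sub>1\<^esub> \<dots> e\<^bsub>x\<^sub>l\<^esub>\<close> is given by the list of edges \<open>[x\<^sub>1, \<dots>, x\<^sub>l]\<close>, so its opposite is given by
  the reversed list; \<open>pi1_word\<close> is the group element that it denotes.
\<close>

definition pi1_word :: "nat \<Rightarrow> 'b sset \<Rightarrow> 'b list \<Rightarrow> 'b gword set" where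
  "pi1_word d Y w = foldr (\<lambda>y g. pi1_gen d Y y \<otimes>\<^bsub>pi1 d Y\<^esub> g) w \<one>\<^bsub>pi1 d Y\<^esub>"

lemma group_pi1:
  assumes "simplicial_set Y"
  shows "group (pi1 d Y)"
proof -
  have "face Y 2 i \<sigma> \<in> simplices Y 1" if "\<sigma> \<in> simplices Y 2" "i \<le> 2" for i \<sigma>
    using simplicial_set.face_closed[OF assms, of i 1 \<sigma>] that by (simp add: numeral_2_eq_2)
  then have "pi1_rels d Y \<subseteq> gwords (simplices Y 1) \<times> gwords (simplices Y 1)"
    by (auto simp: pi1_rels_def) (auto simp: gwords_def)
  then show ?thesis
    unfolding pi1_def by (rule group_presented_group)
qed

end

theory Submission
  imports Defs
begin

text \<open>
  Every relation of \<open>\<pi>\<^sub>1(\<int>\<^sub>d, Y)\<close> stays true when it is read backwards: this is clear for powers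
  and commutators, and the product relation of a triangle reverses because the edges of a triangle
  commute. So reversing words is a well-defined anti-automorphism of the group (\<open>pi1_word_rev\<close>).

  For the twisted product, the triangles over \<open>s\<^sub>0 x\<close> and \<open>s\<^sub>1 x\<close> show that \<open>e\<^sub>1\<close>, taken at either
  end point of \<open>x\<close>, has the same product with \<open>e\<^bsub>b,x\<^esub>\<close>, and that it commutes with it. The
  first fact makes \<open>e\<^sub>1\<close> independent of the vertex when \<open>X\<close> is connected, and then the second
  makes it central.

  Reversing \<open>w = e\<^sub>1\<^sup>a w\<^sup>o\<^sup>p\<close> gives \<open>w\<^sup>o\<^sup>p = w e\<^sub>1\<^sup>a\<close>, so that \<open>w = e\<^sub>1\<^sup>a w e\<^sub>1\<^sup>a = w e\<^sub>1\<^sup>2\<^sup>a\<close> and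
  \<open>e\<^sub>1\<^sup>2\<^sup>a = 1\<close>. Since also \<open>e\<^sub>1\<^sup>d = 1\<close> with \<open>d\<close> odd, it follows that \<open>e\<^sub>1\<^sup>a = 1\<close>.
\<close>

(* The simplifier would otherwise turn the dimension 1 into Suc 0 and miss the facts about edges. *)
declare One_nat_def [simp del]

section \<open>Reversing words\<close>

lemma rev_in_gwords_iff [simp]: "rev u \<in> gwords S \<longleftrightarrow> u \<in> gwords S"
  by (simp add: gwords_def in_lists_conv_set)

lemma pres_eq_rev:
  assumes "\<And>u v. (u, v) \<in> R \<Longrightarrow> pres_eq S R (rev u) (rev v)"
    and "pres_eq S R u v"
  shows "pres_eq S R (rev u) (rev v)"
  using assms(2)
proof induction
  case (refl w)
  then show ?case by (simp add: pres_eq.refl)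
next
  case (sym u v)
  then show ?case by (blast intro: pres_eq.sym)
next
  case (trans u v w)
  then show ?case by (blast intro: pres_eq.trans)
next
  case (cancel s x y b)
  then show ?case
    using pres_eq.cancel[of s S "rev y" "rev x" R "\<not> b"] by simp
next
  case (rel u v x y)
  then show ?case
    using pres_eq_context[OF assms(1)[OF rel(1)], of "rev y" "rev x"] by simp
qed

text \<open>
  The presentation of \<open>\<pi>\<^sub>1(\<int>\<^sub>d, Y)\<close> sees only the edges, the triangles and the faces of triangles,
  so it presents a group as soon as these faces are edges.
\<close>

locale triangle_faces =
  fixes d :: nat and Y :: "'b sset"
  assumes face_edge: "\<sigma> \<in> simplices Y 2 \<Longrightarrow> i \<in> {0, 1, 2} \<Longrightarrow> face Y 2 i \<sigma> \<in> simplices Y 1"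
begin

abbreviation G :: "'b gword set monoid" where "G \<equiv> pi1 d Y"
abbreviation e :: "'b \<Rightarrow> 'b gword set" where "e \<equiv> pi1_gen d Y"
abbreviation cls :: "'b gword \<Rightarrow> 'b gword set" where
  "cls \<equiv> pres_class (simplices Y 1) (pi1_rels d Y)"
abbreviation W :: "'b gword set" where "W \<equiv> gwords (simplices Y 1)"

lemma rels_gwords: "pi1_rels d Y \<subseteq> W \<times> W"
  using face_edge by (auto simp: pi1_rels_def) (auto simp: gwords_def)

sublocale group G
  unfolding pi1_def by (rule group_presented_group[OF rels_gwords])

lemma one_cls: "\<one>\<^bsub>G\<^esub> = cls []"
  by (simp add: pi1_def presented_group_def)

lemma mult_cls: "u \<in> W \<Longrightarrow> v \<in> W \<Longrightarrow> cls u \<otimes>\<^bsub>G\<^esub> cls v = cls (u @ v)"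
  unfolding pi1_def by (rule presented_group_mult[OF rels_gwords])

lemma cls_closed: "u \<in> W \<Longrightarrow> cls u \<in> carrier G"
  by (simp add: pi1_def presented_group_def)

lemma gen_closed [simp]: "y \<in> simplices Y 1 \<Longrightarrow> e y \<in> carrier G"
  by (simp add: pi1_gen_def cls_closed)

lemma cls_False:
  assumes "y \<in> simplices Y 1"
  shows "cls [(False, y)] = inv\<^bsub>G\<^esub> e y"
proof -
  have "pres_eq (simplices Y 1) (pi1_rels d Y) ([] @ [(False, y), (\<not> False, y)] @ []) ([] @ [])"
    using assms by (intro pres_eq.cancel) auto
  then have "cls [(False, y)] \<otimes>\<^bsub>G\<^esub> e y = \<one>\<^bsub>G\<^esub>"
    using assms by (simp add: pi1_gen_def mult_cls one_cls pres_class_eq_iff)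
  then show ?thesis
    using assms by (intro inv_equality[symmetric]) (auto simp: cls_closed)
qed

lemma cls_Cons:
  assumes "y \<in> simplices Y 1" "u \<in> W"
  shows "cls ((b, y) # u) = (if b then e y else inv\<^bsub>G\<^esub> e y) \<otimes>\<^bsub>G\<^esub> cls u"
  using assms mult_cls[of "[(b, y)]" u] cls_False[of y] by (auto simp: pi1_gen_def)

lemma rel_cls:
  assumes "(u, v) \<in> pi1_rels d Y"
  shows "cls u = cls v"
proof -
  have "u \<in> W"
    using assms rels_gwords by auto
  then show ?thesis
    using pres_eq.rel[OF assms, of "[]" "simplices Y 1" "[]"] by (simp add: pres_class_eq_iff)
qed

lemma faces_commute:
  assumes "\<sigma> \<in> simplices Y 2" "i \<in> {0, 1, 2}" "j \<in> {0, 1, 2}"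
  shows "e (face Y 2 i \<sigma>) \<otimes>\<^bsub>G\<^esub> e (face Y 2 j \<sigma>) = e (face Y 2 j \<sigma>) \<otimes>\<^bsub>G\<^esub> e (face Y 2 i \<sigma>)"
proof -
  let ?x = "face Y 2 i \<sigma>" and ?y = "face Y 2 j \<sigma>"
  have xy: "?x \<in> simplices Y 1" "?y \<in> simplices Y 1"
    using assms by (auto intro!: face_edge)
  have "cls [(True, ?x), (True, ?y), (False, ?x), (False, ?y)] = cls []"
    by (rule rel_cls) (use assms in \<open>unfold pi1_rels_def, blast\<close>)
  then have "(e ?x \<otimes>\<^bsub>G\<^esub> e ?y) \<otimes>\<^bsub>G\<^esub> inv\<^bsub>G\<^esub> (e ?y \<otimes>\<^bsub>G\<^esub> e ?x) = \<one>\<^bsub>G\<^esub>"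
    using xy by (simp add: cls_Cons one_cls[symmetric] m_assoc inv_mult_group)
  then show ?thesis
    using xy inv_equality[of "e ?x \<otimes>\<^bsub>G\<^esub> e ?y" "inv\<^bsub>G\<^esub> (e ?y \<otimes>\<^bsub>G\<^esub> e ?x)"] by simp
qed

lemma triangle_product:
  assumes "\<sigma> \<in> simplices Y 2"
  shows "e (face Y 2 2 \<sigma>) \<otimes>\<^bsub>G\<^esub> e (face Y 2 0 \<sigma>) = e (face Y 2 1 \<sigma>)"
proof -
  have "cls [(True, face Y 2 2 \<sigma>), (True, face Y 2 0 \<sigma>)] = cls [(True, face Y 2 1 \<sigma>)]"
    by (rule rel_cls) (use assms in \<open>unfold pi1_rels_def, blast\<close>)
  then show ?thesis
    using face_edge[OF assms, of 2] face_edge[OF assms, of 0] face_edge[OF assms, of 1]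
    by (simp add: cls_Cons one_cls[symmetric])
qed

lemma rev_rel_cls:
  assumes "(u, v) \<in> pi1_rels d Y"
  shows "cls (rev u) = cls (rev v)"
proof -
  consider (power) y where "u = replicate d (True, y)" "v = []"
    | (comm) \<sigma> i j where "\<sigma> \<in> simplices Y 2" "i \<in> {0, 1, 2}" "j \<in> {0, 1, 2}" "v = []"
        "u = [(True, face Y 2 i \<sigma>), (True, face Y 2 j \<sigma>),
              (False, face Y 2 i \<sigma>), (False, face Y 2 j \<sigma>)]"
    | (triangle) \<sigma> where "\<sigma> \<in> simplices Y 2" "v = [(True, face Y 2 1 \<sigma>)]"
        "u = [(True, face Y 2 2 \<sigma>), (True, face Y 2 0 \<sigma>)]"
    using assms unfolding pi1_rels_def by blast
  then show ?thesis
  proof cases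
    case power
    then show ?thesis using rel_cls[OF assms] by simp
  next
    case comm
    let ?x = "face Y 2 i \<sigma>" and ?y = "face Y 2 j \<sigma>"
    have xy: "?x \<in> simplices Y 1" "?y \<in> simplices Y 1"
      using comm by (auto intro!: face_edge)
    have "cls (rev u) = inv\<^bsub>G\<^esub> (e ?x \<otimes>\<^bsub>G\<^esub> e ?y) \<otimes>\<^bsub>G\<^esub> (e ?y \<otimes>\<^bsub>G\<^esub> e ?x)"
      using comm xy by (simp add: cls_Cons one_cls[symmetric] m_assoc inv_mult_group)
    also have "\<dots> = \<one>\<^bsub>G\<^esub>"
      using faces_commute[OF comm(1-3)] xy by simp
    finally show ?thesis
      using comm(4) by (simp add: one_cls)
  next
    case triangle
    have "e (face Y 2 0 \<sigma>) \<otimes>\<^bsub>G\<^esub> e (face Y 2 2 \<sigma>) = e (face Y 2 1 \<sigma>)"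
      using triangle_product[OF triangle(1)] faces_commute[OF triangle(1), of 0 2] by simp
    then show ?thesis
      using triangle face_edge[OF triangle(1), of 2] face_edge[OF triangle(1), of 0]
        face_edge[OF triangle(1), of 1]
      by (simp add: cls_Cons one_cls[symmetric])
  qed
qed

lemma cls_rev:
  assumes "u \<in> W" "cls u = cls v"
  shows "cls (rev u) = cls (rev v)"
proof -
  have "pres_eq (simplices Y 1) (pi1_rels d Y) (rev s) (rev t)" if "(s, t) \<in> pi1_rels d Y" for s t
  proof -
    have "rev s \<in> W"
      using that rels_gwords by auto
    then show ?thesis
      using rev_rel_cls[OF that] pres_class_eq_iff by blast
  qed
  moreover have "pres_eq (simplices Y 1) (pi1_rels d Y) u v"
    using assms pres_class_eq_iff by blast
  ultimately have "pres_eq (simplices Y 1) (pi1_rels d Y) (rev u) (rev v)"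
    by (rule pres_eq_rev)
  then show ?thesis
    using assms(1) by (simp add: pres_class_eq_iff)
qed

lemma map_in_W: "w \<in> lists (simplices Y 1) \<Longrightarrow> map (Pair True) w \<in> W"
  by (auto simp: gwords_def)

lemma pi1_word_cls: "w \<in> lists (simplices Y 1) \<Longrightarrow> pi1_word d Y w = cls (map (Pair True) w)"
  by (induction w) (auto simp: pi1_word_def one_cls cls_Cons map_in_W)

lemma pi1_word_closed [simp]: "w \<in> lists (simplices Y 1) \<Longrightarrow> pi1_word d Y w \<in> carrier G"
  by (simp add: pi1_word_cls map_in_W cls_closed)

lemma pi1_word_append:
  assumes "w \<in> lists (simplices Y 1)" "w' \<in> lists (simplices Y 1)"
  shows "pi1_word d Y (w @ w') = pi1_word d Y w \<otimes>\<^bsub>G\<^esub> pi1_word d Y w'"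
  using assms by (simp add: pi1_word_cls map_in_W mult_cls)

lemma pi1_word_replicate:
  assumes "y \<in> simplices Y 1"
  shows "pi1_word d Y (replicate n y) = e y [^]\<^bsub>G\<^esub> n"
proof (induction n)
  case 0
  then show ?case by (simp add: pi1_word_def)
next
  case (Suc n)
  then have "pi1_word d Y (replicate (Suc n) y) = e y \<otimes>\<^bsub>G\<^esub> e y [^]\<^bsub>G\<^esub> n"
    by (simp add: pi1_word_def)
  then show ?case
    using assms by (simp add: nat_pow_Suc2[symmetric] del: nat_pow_Suc)
qed

lemma pi1_word_rev:
  assumes "w \<in> lists (simplices Y 1)" "w' \<in> lists (simplices Y 1)"
    and "pi1_word d Y w = pi1_word d Y w'"
  shows "pi1_word d Y (rev w) = pi1_word d Y (rev w')"
proof -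
  have "rev w \<in> lists (simplices Y 1)" "rev w' \<in> lists (simplices Y 1)"
    using assms(1,2) by auto
  then show ?thesis
    using assms cls_rev[of "map (Pair True) w" "map (Pair True) w'"]
    by (simp add: pi1_word_cls map_in_W rev_map)
qed

lemma gen_pow_d:
  assumes "y \<in> simplices Y 1"
  shows "e y [^]\<^bsub>G\<^esub> d = \<one>\<^bsub>G\<^esub>"
proof -
  have "cls (replicate d (True, y)) = cls []"
    by (rule rel_cls) (use assms in \<open>unfold pi1_rels_def, blast\<close>)
  then show ?thesis
    using pi1_word_replicate[OF assms, of d] assms
    by (simp add: pi1_word_cls one_cls in_lists_conv_set)
qed

lemma commutes_with_word:
  assumes "g \<in> carrier G" "\<And>y. y \<in> simplices Y 1 \<Longrightarrow> g \<otimes>\<^bsub>G\<^esub> e y = e y \<otimes>\<^bsub>G\<^esub> g"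
    and "w \<in> lists (simplices Y 1)"
  shows "g \<otimes>\<^bsub>G\<^esub> pi1_word d Y w = pi1_word d Y w \<otimes>\<^bsub>G\<^esub> g"
  using assms(3)
proof (induction w)
  case Nil
  then show ?case using assms(1) by (simp add: pi1_word_def)
next
  case (Cons y w)
  then have y: "e y \<in> carrier G" and w: "pi1_word d Y w \<in> carrier G"
    by simp_all
  have step: "pi1_word d Y (y # w) = e y \<otimes>\<^bsub>G\<^esub> pi1_word d Y w"
    by (simp add: pi1_word_def)
  have "g \<otimes>\<^bsub>G\<^esub> (e y \<otimes>\<^bsub>G\<^esub> pi1_word d Y w) = e y \<otimes>\<^bsub>G\<^esub> (g \<otimes>\<^bsub>G\<^esub> pi1_word d Y w)"
    using assms(1,2) Cons.hyps y w by (simp add: m_assoc[symmetric])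
  then show ?case
    using assms(1) Cons y w step by (simp add: m_assoc)
qed

text \<open>
  Put \<open>z = e\<^sub>y\<^sup>n\<close>. Reversing \<open>w = z w\<^sup>o\<^sup>p\<close> and substituting the result back gives \<open>w = z w z\<close>, so
  \<open>z\<^sup>2 = 1\<close> by centrality; also \<open>z\<^sup>d = 1\<close>, and \<open>2\<close> is coprime to \<open>d\<close>.
\<close>

lemma central_power_trivial:
  fixes n :: nat
  assumes "odd d" and y: "y \<in> simplices Y 1"
    and central: "\<And>x. x \<in> simplices Y 1 \<Longrightarrow> e y \<otimes>\<^bsub>G\<^esub> e x = e x \<otimes>\<^bsub>G\<^esub> e y"
    and w: "w \<in> lists (simplices Y 1)"
    and eq: "pi1_word d Y w = e y [^]\<^bsub>G\<^esub> n \<otimes>\<^bsub>G\<^esub> pi1_word d Y (rev w)"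
  shows "e y [^]\<^bsub>G\<^esub> n = \<one>\<^bsub>G\<^esub>"
proof -
  let ?z = "e y [^]\<^bsub>G\<^esub> n" and ?w = "pi1_word d Y w"
  have mem: "rev w \<in> lists (simplices Y 1)" "replicate n y \<in> lists (simplices Y 1)"
    using w y by (auto simp: in_lists_conv_set)
  have zw: "?z \<in> carrier G" "?w \<in> carrier G"
    using y w by simp_all
  have "?w = pi1_word d Y (replicate n y @ rev w)"
    using eq mem y by (simp add: pi1_word_append pi1_word_replicate)
  then have "pi1_word d Y (rev w) = pi1_word d Y (rev (replicate n y @ rev w))"
    using w mem by (intro pi1_word_rev) simp_all
  then have "pi1_word d Y (rev w) = ?w \<otimes>\<^bsub>G\<^esub> ?z"
    using w mem y by (simp add: pi1_word_append pi1_word_replicate)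
  moreover have "?w \<otimes>\<^bsub>G\<^esub> ?z = ?z \<otimes>\<^bsub>G\<^esub> ?w"
  proof (rule commutes_with_word[symmetric, OF zw(1) _ w])
    show "?z \<otimes>\<^bsub>G\<^esub> e x = e x \<otimes>\<^bsub>G\<^esub> ?z" if "x \<in> simplices Y 1" for x
      using group_commutes_pow[OF central[OF that]] that y by simp
  qed
  ultimately have "\<one>\<^bsub>G\<^esub> \<otimes>\<^bsub>G\<^esub> ?w = (?z \<otimes>\<^bsub>G\<^esub> ?z) \<otimes>\<^bsub>G\<^esub> ?w"
    using eq zw by (simp add: m_assoc)
  then have sq: "?z [^]\<^bsub>G\<^esub> (2::nat) = \<one>\<^bsub>G\<^esub>"
    using zw by (simp add: numeral_2_eq_2)
  have pd: "?z [^]\<^bsub>G\<^esub> d = \<one>\<^bsub>G\<^esub>"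
    using gen_pow_d[OF y] y nat_pow_pow[of "e y" n d] nat_pow_pow[of "e y" d n]
    by (simp add: mult.commute[of n d])
  obtain k where k: "d = Suc (2 * k)"
    using \<open>odd d\<close> by (auto elim: oddE)
  have "?z [^]\<^bsub>G\<^esub> Suc (2 * k) = (?z [^]\<^bsub>G\<^esub> (2::nat)) [^]\<^bsub>G\<^esub> k \<otimes>\<^bsub>G\<^esub> ?z"
    using zw(1) by (simp add: nat_pow_pow)
  also have "\<dots> = ?z"
    using sq zw(1) by simp
  also have "?z [^]\<^bsub>G\<^esub> Suc (2 * k) = \<one>\<^bsub>G\<^esub>"
    using pd by (simp only: k[symmetric])
  finally show ?thesis ..
qed

end


section \<open>Edges and triangles of the twisted product\<close>

lemma simplices_twisted_product_1:
  "y \<in> simplices (twisted_product d X \<gamma>) 1 \<longleftrightarrow> (\<exists>b x. y = ([b], x) \<and> b \<in> Zd d \<and> x \<in> simplices X 1)"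
  by (cases y) (auto simp: twisted_product_def nerve_Zd_def length_Suc_conv One_nat_def)

lemma simplices_twisted_product_2:
  "\<sigma> \<in> simplices (twisted_product d X \<gamma>) 2
     \<longleftrightarrow> (\<exists>b c x. \<sigma> = ([b, c], x) \<and> b \<in> Zd d \<and> c \<in> Zd d \<and> x \<in> simplices X 2)"
  by (cases \<sigma>)
    (auto simp: twisted_product_def nerve_Zd_def length_Suc_conv numeral_2_eq_2 One_nat_def)

lemma twisted_product_face1_2:
  "face (twisted_product d X \<gamma>) 2 1 ([b, c], \<sigma>) = ([(b + c) mod int d], face X 2 1 \<sigma>)"
  by (simp add: twisted_product_def nerve_Zd_def)

lemma twisted_product_face2_2:
  "face (twisted_product d X \<gamma>) 2 2 ([b, c], \<sigma>) = ([b], face X 2 2 \<sigma>)"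
  by (simp add: twisted_product_def nerve_Zd_def)

lemma triangle_faces_twisted_product:
  assumes "simplicial_set X" "0 < d"
  shows "triangle_faces (twisted_product d X \<gamma>)"
proof
  fix \<sigma> :: "int list \<times> 'a" and i :: nat
  assume \<sigma>: "\<sigma> \<in> simplices (twisted_product d X \<gamma>) 2" and i: "i \<in> {0, 1, 2}"
  have "face X 2 i x \<in> simplices X 1" if "x \<in> simplices X 2" for x
    using simplicial_set.face_closed[OF assms(1), of i 1 x] that i by (auto simp: numeral_2_eq_2 One_nat_def)
  moreover have "t mod int d \<in> Zd d" for t
    using assms(2) by (simp add: Zd_def)
  ultimately show "face (twisted_product d X \<gamma>) 2 i \<sigma> \<in> simplices (twisted_product d X \<gamma>) 1"
    using \<sigma> i
    by (auto simp: simplices_twisted_product_1 simplices_twisted_product_2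
        twisted_product_face0_2 twisted_product_face1_2 twisted_product_face2_2)
qed


section \<open>Centrality of \<open>e\<^sub>1\<close>\<close>

locale normalized_twist = simplicial_set X for X :: "'a sset" +
  fixes d :: nat and \<gamma> :: "'a \<Rightarrow> int"
  assumes d_gt_1: "1 < d" and normalized: "normalized2 X \<gamma>"
begin

abbreviation Y :: "(int list \<times> 'a) sset" where "Y \<equiv> twisted_product d X \<gamma>"

sublocale P: triangle_faces d Y
  using triangle_faces_twisted_product[OF simplicial_set_axioms] d_gt_1 by simp

abbreviation E :: "int \<Rightarrow> 'a \<Rightarrow> (int list \<times> 'a) gword set" where "E b x \<equiv> P.e ([b], x)"

lemma edge_in_Y: "b \<in> Zd d \<Longrightarrow> x \<in> simplices X 1 \<Longrightarrow> ([b], x) \<in> simplices Y 1"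
  by (simp add: simplices_twisted_product_1)

lemma one_in_Zd: "1 \<in> Zd d"
  using d_gt_1 by (simp add: Zd_def)

lemma vertex_loop_in_Y: "u \<in> simplices X 0 \<Longrightarrow> ([1], degen X 0 0 u) \<in> simplices Y 1"
  using degen_closed[of 0 0 u] by (simp add: edge_in_Y one_in_Zd flip: One_nat_def)

lemma edge_vertices:
  assumes "x \<in> simplices X 1"
  shows "face X 1 0 x \<in> simplices X 0" "face X 1 1 x \<in> simplices X 0"
  using face_closed[of _ 0 x] assms by (simp_all add: One_nat_def)

text \<open>
  The triangle \<open>([1, b], s\<^sub>0 x)\<close> has the faces \<open>d\<^sub>2 = ([1], s\<^sub>0 d\<^sub>1 x)\<close>, \<open>d\<^sub>0 = ([b], x)\<close> and
  \<open>d\<^sub>1 = ([b + 1], x)\<close>; normalization keeps the twist out of \<open>d\<^sub>0\<close>.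
\<close>

lemma loop_at_source:
  assumes b: "b \<in> Zd d" and x: "x \<in> simplices X 1"
  shows "E 1 (degen X 0 0 (face X 1 1 x)) \<otimes>\<^bsub>P.G\<^esub> E b x = E ((b + 1) mod int d) x"
    and "E 1 (degen X 0 0 (face X 1 1 x)) \<otimes>\<^bsub>P.G\<^esub> E b x
          = E b x \<otimes>\<^bsub>P.G\<^esub> E 1 (degen X 0 0 (face X 1 1 x))"
proof -
  let ?\<sigma> = "([1, b], degen X 1 0 x)"
  have \<sigma>: "?\<sigma> \<in> simplices Y 2"
    using degen_closed[of 0 1 x] b x one_in_Zd
    by (simp add: simplices_twisted_product_2)
  have "face X 2 0 (degen X 1 0 x) = x" "face X 2 1 (degen X 1 0 x) = x"
    "face X 2 2 (degen X 1 0 x) = degen X 0 0 (face X 1 1 x)"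
    using face_degen_same[of 0 1 x] face_degen_Suc[of 0 1 x] face_degen_greater[of 0 2 0 x] x
    by (simp_all add: numeral_2_eq_2 One_nat_def)
  moreover have "\<gamma> (degen X 1 0 x) = 0"
    using normalized x by (simp add: normalized2_def)
  moreover have "b mod int d = b"
    using b by (simp add: Zd_def)
  ultimately have "face Y 2 0 ?\<sigma> = ([b], x)" "face Y 2 1 ?\<sigma> = ([(b + 1) mod int d], x)"
    "face Y 2 2 ?\<sigma> = ([1], degen X 0 0 (face X 1 1 x))"
    by (simp_all add: twisted_product_face0_2 twisted_product_face1_2 twisted_product_face2_2
        add.commute)
  then show "E 1 (degen X 0 0 (face X 1 1 x)) \<otimes>\<^bsub>P.G\<^esub> E b x = E ((b + 1) mod int d) x"
    and "E 1 (degen X 0 0 (face X 1 1 x)) \<otimes>\<^bsub>P.G\<^esub> E b x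
          = E b x \<otimes>\<^bsub>P.G\<^esub> E 1 (degen X 0 0 (face X 1 1 x))"
    using P.triangle_product[OF \<sigma>] P.faces_commute[OF \<sigma>, of 2 0] by simp_all
qed

text \<open>
  The triangle \<open>([b, 1], s\<^sub>1 x)\<close> has the faces \<open>d\<^sub>2 = ([b], x)\<close>, \<open>d\<^sub>0 = ([1], s\<^sub>0 d\<^sub>0 x)\<close> and
  \<open>d\<^sub>1 = ([b + 1], x)\<close>. Its product relation has the loop on the right, and commutation moves it
  to the left.
\<close>

lemma loop_at_target:
  assumes b: "b \<in> Zd d" and x: "x \<in> simplices X 1"
  shows "E 1 (degen X 0 0 (face X 1 0 x)) \<otimes>\<^bsub>P.G\<^esub> E b x = E ((b + 1) mod int d) x"
proof -
  let ?\<sigma> = "([b, 1], degen X 1 1 x)"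
  have \<sigma>: "?\<sigma> \<in> simplices Y 2"
    using degen_closed[of 1 1 x] b x one_in_Zd
    by (simp add: simplices_twisted_product_2)
  have "face X 2 0 (degen X 1 1 x) = degen X 0 0 (face X 1 0 x)"
    "face X 2 1 (degen X 1 1 x) = x" "face X 2 2 (degen X 1 1 x) = x"
    using face_degen_same[of 1 1 x] face_degen_Suc[of 1 1 x] face_degen_less[of 0 1 0 x] x
    by (simp_all add: numeral_2_eq_2 One_nat_def)
  moreover have "\<gamma> (degen X 1 1 x) = 0"
    using normalized x by (simp add: normalized2_def)
  ultimately have "face Y 2 0 ?\<sigma> = ([1], degen X 0 0 (face X 1 0 x))"
    "face Y 2 1 ?\<sigma> = ([(b + 1) mod int d], x)" "face Y 2 2 ?\<sigma> = ([b], x)"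
    using d_gt_1
    by (simp_all add: twisted_product_face0_2 twisted_product_face1_2 twisted_product_face2_2)
  then show ?thesis
    using P.triangle_product[OF \<sigma>] P.faces_commute[OF \<sigma>, of 2 0] by simp
qed

text \<open>Both loops multiply \<open>e\<^bsub>1,x\<^esub>\<close> to the same element, so they cancel to an equality.\<close>

lemma loop_source_eq_target:
  assumes x: "x \<in> simplices X 1"
  shows "E 1 (degen X 0 0 (face X 1 1 x)) = E 1 (degen X 0 0 (face X 1 0 x))"
proof -
  let ?s = "E 1 (degen X 0 0 (face X 1 1 x))" and ?t = "E 1 (degen X 0 0 (face X 1 0 x))"
  have "?s \<otimes>\<^bsub>P.G\<^esub> E 1 x = ?t \<otimes>\<^bsub>P.G\<^esub> E 1 x"
    using loop_at_source(1) loop_at_target one_in_Zd x by simp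
  moreover have "?s \<in> carrier P.G" "?t \<in> carrier P.G" "E 1 x \<in> carrier P.G"
    using x by (simp_all add: vertex_loop_in_Y edge_in_Y one_in_Zd edge_vertices)
  ultimately show ?thesis
    by (simp only: P.right_cancel)
qed

lemma loop_independent_of_vertex:
  assumes "connected_sset X" "u \<in> simplices X 0" "v \<in> simplices X 0"
  shows "E 1 (degen X 0 0 u) = E 1 (degen X 0 0 v)"
proof -
  have "(u, v) \<in> (edge_rel X \<union> (edge_rel X)\<inverse>)\<^sup>*"
    using assms by (simp add: connected_sset_def)
  then show ?thesis
  proof induction
    case base
    show ?case ..
  next
    case (step s t)
    then have "E 1 (degen X 0 0 s) = E 1 (degen X 0 0 t)"
      using loop_source_eq_target by (auto simp: edge_rel_def)
    then show ?case using step.IH by simp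
  qed
qed

lemma loop_central:
  assumes "connected_sset X" "v \<in> simplices X 0" "y \<in> simplices Y 1"
  shows "E 1 (degen X 0 0 v) \<otimes>\<^bsub>P.G\<^esub> P.e y = P.e y \<otimes>\<^bsub>P.G\<^esub> E 1 (degen X 0 0 v)"
proof -
  obtain b x where y: "y = ([b], x)" "b \<in> Zd d" "x \<in> simplices X 1"
    using assms(3) by (auto simp: simplices_twisted_product_1)
  have "E 1 (degen X 0 0 v) = E 1 (degen X 0 0 (face X 1 1 x))"
    using loop_independent_of_vertex[OF assms(1,2)] edge_vertices(2)[OF y(3)] by simp
  then show ?thesis
    using loop_at_source(2)[OF y(2,3)] y(1) by simp
qed

end


theorem proposition3p22:
  fixes d :: nat and X :: "'a sset" and \<gamma> :: "'a \<Rightarrow> int"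
    and v :: 'a and w :: "(int list \<times> 'a) list" and a :: int
  defines "Y \<equiv> twisted_product d X \<gamma>"
  defines "e1 \<equiv> pi1_gen d Y ([1], degen X 0 0 v)"
  assumes "1 < d" and "odd d"
    and "simplicial_set X" and "connected_sset X"
    and "cocycle2 d X \<gamma>" and "normalized2 X \<gamma>"
    and "v \<in> simplices X 0"
    and "w \<in> lists (simplices Y 1)"
    and "a \<in> Zd d"
    and "pi1_word d Y w = e1 [^]\<^bsub>pi1 d Y\<^esub> a \<otimes>\<^bsub>pi1 d Y\<^esub> pi1_word d Y (rev w)"
  shows "pi1_word d Y w = pi1_word d Y (rev w)"
proof -
  interpret normalized_twist X d \<gamma>
    using assms(3,5,8) by (intro normalized_twist.intro normalized_twist_axioms.intro)
  let ?l = "([1], degen X 0 0 v)"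
  have a: "e1 [^]\<^bsub>pi1 d Y\<^esub> a = e1 [^]\<^bsub>pi1 d Y\<^esub> nat a"
    using \<open>a \<in> Zd d\<close> int_pow_int[of "pi1 d Y" e1 "nat a"] by (simp only: Zd_def) simp
  have "e1 [^]\<^bsub>pi1 d Y\<^esub> nat a = \<one>\<^bsub>pi1 d Y\<^esub>"
    unfolding Y_def e1_def
  proof (rule P.central_power_trivial[OF assms(4) _ _ assms(10)[unfolded Y_def]])
    show "?l \<in> simplices (twisted_product d X \<gamma>) 1"
      using assms(9) by (rule vertex_loop_in_Y)
    show "P.e ?l \<otimes>\<^bsub>P.G\<^esub> P.e x = P.e x \<otimes>\<^bsub>P.G\<^esub> P.e ?l"
      if "x \<in> simplices (twisted_product d X \<gamma>) 1" for x
      using assms(6,9) that by (rule loop_central)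
    show "pi1_word d (twisted_product d X \<gamma>) w
        = P.e ?l [^]\<^bsub>P.G\<^esub> nat a \<otimes>\<^bsub>P.G\<^esub> pi1_word d (twisted_product d X \<gamma>) (rev w)"
      using assms(12)[unfolded a] unfolding Y_def e1_def .
  qed
  moreover have "pi1_word d Y (rev w) \<in> carrier (pi1 d Y)"
    unfolding Y_def by (rule P.pi1_word_closed) (use assms(10) in \<open>auto simp: Y_def\<close>)
  ultimately show ?thesis
    using assms(12)[unfolded a] unfolding Y_def by (simp only: P.l_one)
qed

end
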